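(* Let $P=(X,\prec)$ be a finite poset with $|X|=n$ elements, and let $r$ be the number of maximal elements of $P$. Then for every $t\in\mathbb N$, $$\Omega(P,t)\ \geq\ t^r\,(t+1)^{n-r}\prod_{x\in X}\frac{1}{b(x)}.$$
   Context: For $x\in X$, $b(x):=|\{y\in X: y\succcurlyeq x\}|$ is the size of the upper order ideal generated by $x$. For an integer $t\ge 1$, $\Omega(P,t)$ (the order polynomial) is the number of maps $g:X\to[t]=\{1,\dots,t\}$ such that $g(x)\le g(y)$ whenever $x\prec y$. $\mathbb N=\{0,1,2,\dots\}$. *)

theory Defs
  imports Complex_Main "HOL-Library.FuncSet"
begin

text \<open>
  A finite poset is a finite set \<open>X\<close> with a relation \<open>R\<close> such that \<^term>\<open>partial_order_on X R\<close>.
  Here \<open>(x, y) \<in> R\<close> is the reflexive order \<open>x \<preceq> y\<close>; the strict order \<open>x \<prec> y\<close> is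
  \<open>(x, y) \<in> R \<and> x \<noteq> y\<close>.
\<close>

definition maximal_elements :: "'a set \<Rightarrow> ('a \<times> 'a) set \<Rightarrow> 'a set" where
  "maximal_elements X R = {x \<in> X. \<not> (\<exists>y\<in>X. (x, y) \<in> R \<and> x \<noteq> y)}"

definition upper_ideal_size :: "'a set \<Rightarrow> ('a \<times> 'a) set \<Rightarrow> 'a \<Rightarrow> nat" where
  "upper_ideal_size X R x = card {y \<in> X. (x, y) \<in> R}"

text \<open>
  Maps \<open>X \<rightarrow> [t]\<close> are extensional functions, so that each is counted once. For \<open>t = 0\<close>
  the codomain is empty, giving the value \<open>0\<close> if \<open>X \<noteq> {}\<close> and \<open>1\<close> if \<open>X = {}\<close>.
\<close>

definition order_polynomial :: "'a set \<Rightarrow> ('a \<times> 'a) set \<Rightarrow> nat \<Rightarrow> nat" where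
  "order_polynomial X R t =
     card {g \<in> X \<rightarrow>\<^sub>E {1..t}. \<forall>x\<in>X. \<forall>y\<in>X. (x, y) \<in> R \<and> x \<noteq> y \<longrightarrow> g x \<le> g y}"

end

theory Submission
  imports Defs
begin

text \<open>
  Remove a minimal element \<open>x\<close>, and let \<open>U\<close> be the set of the \<open>k\<close> elements strictly above it.
  An order preserving map \<open>g\<close> of the remaining poset \<open>Q\<close> extends to \<open>x\<close> in as many ways as there
  are \<open>j < t\<close> with \<open>j < g u\<close> for all \<open>u \<in> U\<close>, so \<open>\<Omega>(P,t) = \<Sum>j<t. F j\<close> where \<open>F j\<close> counts the \<open>g\<close>
  with \<open>g > j\<close> on \<open>U\<close>. If such a \<open>g\<close> misses on \<open>U\<close> the value \<open>i > j\<close>, then raising by one those of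
  its values on \<open>U\<close> that are below \<open>i\<close> gives a map counted by \<open>F (j + 1)\<close>, from which \<open>g\<close> can be
  recovered given \<open>i\<close>. As \<open>g\<close> misses at least \<open>t - j - k\<close> values, this yields
  \<open>(t - j) F (j + 1) \<ge> (t - j - k) F j\<close>, and summation gives \<open>(k + 1) \<Omega>(P,t) \<ge> (t + 1) \<Omega>(Q,t)\<close>
  whenever \<open>U\<close> is nonempty.
\<close>

definition order_maps :: "'a set \<Rightarrow> ('a \<times> 'a) set \<Rightarrow> nat \<Rightarrow> ('a \<Rightarrow> nat) set" where
  "order_maps X R t =
     {g \<in> X \<rightarrow>\<^sub>E {1..t}. \<forall>x\<in>X. \<forall>y\<in>X. (x, y) \<in> R \<and> x \<noteq> y \<longrightarrow> g x \<le> g y}"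

definition order_maps_above ::
  "'a set \<Rightarrow> ('a \<times> 'a) set \<Rightarrow> nat \<Rightarrow> 'a set \<Rightarrow> nat \<Rightarrow> ('a \<Rightarrow> nat) set" where
  "order_maps_above X R t U j = {g \<in> order_maps X R t. \<forall>u\<in>U. j < g u}"

lemma order_polynomial_eq_card: "order_polynomial X R t = card (order_maps X R t)"
  by (simp add: order_polynomial_def order_maps_def)

lemma finite_order_maps: "finite X \<Longrightarrow> finite (order_maps X R t)"
  unfolding order_maps_def by (rule finite_subset[of _ "X \<rightarrow>\<^sub>E {1..t}"]) (auto intro: finite_PiE)

lemma finite_order_maps_above: "finite X \<Longrightarrow> finite (order_maps_above X R t U j)"
  by (simp add: order_maps_above_def finite_order_maps)

lemma order_maps_above_empty: "order_maps_above X R t {} j = order_maps X R t"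
  by (simp add: order_maps_above_def)

lemma order_maps_above_0:
  assumes "U \<subseteq> X"
  shows "order_maps_above X R t U 0 = order_maps X R t"
  using assms by (fastforce simp: order_maps_above_def order_maps_def PiE_iff)

lemma order_maps_above_top:
  assumes "U \<subseteq> X" "U \<noteq> {}"
  shows "order_maps_above X R t U t = {}"
  using assms by (fastforce simp: order_maps_above_def order_maps_def PiE_iff)

section \<open>Raising values on an up-set\<close>

definition raise_below :: "'a set \<Rightarrow> nat \<Rightarrow> ('a \<Rightarrow> nat) \<Rightarrow> 'a \<Rightarrow> nat" where
  "raise_below U i g = (\<lambda>x. if x \<in> U \<and> g x < i then g x + 1 else g x)"

text \<open>The order survives because \<open>U\<close> is closed upwards: if \<open>x\<close> is
  raised and \<open>y\<close> above it is not, then \<open>g y \<ge> i > g x\<close>. Only values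
  below \<open>i \<le> t\<close> grow, so none exceeds \<open>t\<close>. An unraised value on
  \<open>U\<close> is different from \<open>i\<close>, hence larger than
  \<open>i \<ge> j + 1\<close>.\<close>

lemma raise_below_order_maps_above:
  assumes U: "U \<subseteq> X" "\<And>u y. u \<in> U \<Longrightarrow> y \<in> X \<Longrightarrow> (u, y) \<in> R \<Longrightarrow> y \<in> U"
    and g: "g \<in> order_maps_above X R t U j"
    and i: "i \<in> {j+1..t} - g ` U"
  shows "raise_below U i g \<in> order_maps_above X R t U (j + 1)"
proof -
  have gX: "g \<in> X \<rightarrow>\<^sub>E {1..t}"
    and gmono: "\<And>x y. x \<in> X \<Longrightarrow> y \<in> X \<Longrightarrow> (x, y) \<in> R \<Longrightarrow> x \<noteq> y \<Longrightarrow> g x \<le> g y"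
    and gU: "\<And>u. u \<in> U \<Longrightarrow> j < g u"
    using g by (auto simp: order_maps_above_def order_maps_def)
  have "raise_below U i g \<in> X \<rightarrow>\<^sub>E {1..t}"
    using gX U(1) i by (fastforce simp: raise_below_def PiE_iff extensional_def)
  moreover have "raise_below U i g x \<le> raise_below U i g y"
    if "x \<in> X" "y \<in> X" "(x, y) \<in> R" "x \<noteq> y" for x y
    using gmono[OF that] U(2)[of x y] that by (auto simp: raise_below_def)
  moreover have "j + 1 < raise_below U i g u" if "u \<in> U" for u
    using gU[OF that] i that by (force simp: raise_below_def)
  ultimately show ?thesis
    by (simp add: order_maps_above_def order_maps_def)
qed

text \<open>On \<open>U\<close>, raised values end up at most \<open>i\<close> and unraised ones
  stay above \<open>i\<close>, so the result shows what was raised.\<close>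

lemma raise_below_inj:
  assumes "raise_below U i g = raise_below U i h" "i \<notin> g ` U" "i \<notin> h ` U"
  shows "g = h"
proof
  fix x
  show "g x = h x"
  proof (cases "x \<in> U")
    case True
    then have "g x \<noteq> i" "h x \<noteq> i" using assms by auto
    then show ?thesis
      using True fun_cong[OF assms(1), of x] by (auto simp: raise_below_def split: if_splits)
  next
    case False
    then show ?thesis using fun_cong[OF assms(1), of x] by (simp add: raise_below_def)
  qed
qed

text \<open>Double counting of the pairs \<open>(g, i)\<close> where \<open>i > j\<close> is a value
  missed by \<open>g\<close> on \<open>U\<close>. Truncated subtraction is harmless: for
  \<open>card U \<ge> t - j\<close> the left side is 0.\<close>

lemma card_order_maps_above_Suc:
  assumes fin: "finite X"
    and U: "U \<subseteq> X" "\<And>u y. u \<in> U \<Longrightarrow> y \<in> X \<Longrightarrow> (u, y) \<in> R \<Longrightarrow> y \<in> U"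
  shows "(t - j - card U) * card (order_maps_above X R t U j)
           \<le> (t - j) * card (order_maps_above X R t U (j + 1))"
proof -
  let ?F = "order_maps_above X R t U"
  let ?A = "SIGMA g:?F j. {j+1..t} - g ` U"
  have finU: "finite U" using fin U(1) finite_subset by blast
  have "t - j - card U \<le> card ({j+1..t} - g ` U)" for g
  proof -
    have "t - j - card U \<le> card {j+1..t} - card (g ` U)"
      using card_image_le[OF finU, of g] by simp
    also have "\<dots> \<le> card ({j+1..t} - g ` U)"
      using finU by (intro diff_card_le_card_Diff) simp
    finally show ?thesis .
  qed
  then have "(t - j - card U) * card (?F j) \<le> (\<Sum>g\<in>?F j. card ({j+1..t} - g ` U))"
    using sum_bounded_below[of "?F j" "t - j - card U" "\<lambda>g. card ({j+1..t} - g ` U)"]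
    by (simp add: mult.commute)
  also have "\<dots> = card ?A"
    using finite_order_maps_above[OF fin] by (simp add: card_SigmaI)
  also have "\<dots> \<le> card (?F (j + 1) \<times> {j+1..t})"
  \<comment> \<open>The image keeps \<open>i\<close>, since \<open>g\<close> can be recovered only
    when \<open>i\<close> is known.\<close>
  proof (rule card_inj_on_le[of "\<lambda>(g, i). (raise_below U i g, i)"])
    show "inj_on (\<lambda>(g, i). (raise_below U i g, i)) ?A"
      by (auto simp: inj_on_def dest: raise_below_inj)
    show "(\<lambda>(g, i). (raise_below U i g, i)) ` ?A \<subseteq> ?F (j + 1) \<times> {j+1..t}"
      using raise_below_order_maps_above[OF U] by auto
    show "finite (?F (j + 1) \<times> {j+1..t})"
      using finite_order_maps_above[OF fin] by simp
  qed
  also have "\<dots> = (t - j) * card (?F (j + 1))"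
    by (simp add: card_cartesian_product)
  finally show ?thesis .
qed

lemma sum_card_order_maps_above:
  assumes fin: "finite X"
    and U: "U \<subseteq> X" "\<And>u y. u \<in> U \<Longrightarrow> y \<in> X \<Longrightarrow> (u, y) \<in> R \<Longrightarrow> y \<in> U"
    and ne: "U \<noteq> {}"
  shows "(t + 1) * card (order_maps X R t)
           \<le> (card U + 1) * (\<Sum>j<t. card (order_maps_above X R t U j))"
proof -
  let ?F = "\<lambda>j. card (order_maps_above X R t U j)"
  \<comment> \<open>The claim is generalized to tails of the sum and proved downwards from
    \<open>j = t\<close>, where the sum is empty and \<open>?F t = 0\<close> because
    \<open>U\<close> is nonempty. The goal is the case \<open>j = 0\<close>.\<close>
  have "(t - j + 1) * ?F j \<le> (card U + 1) * sum ?F {j..<t}" if "j \<le> t" for j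
    using that
  proof (induction rule: inc_induct)
    case base
    show ?case using order_maps_above_top[OF U(1) ne] by simp
  next
    case (step j)
    have "(t - j + 1) * ?F j \<le> (card U + 1) * ?F j + (t - j - card U) * ?F j"
      unfolding add_mult_distrib[symmetric] by (intro mult_le_mono1) simp
    also have "\<dots> \<le> (card U + 1) * ?F j + (t - j) * ?F (j + 1)"
      using card_order_maps_above_Suc[OF fin U] by (intro add_left_mono)
    \<comment> \<open>The induction hypothesis at \<open>Suc j\<close> has the coefficient
      \<open>t - Suc j + 1\<close>, which is \<open>t - j\<close>.\<close>
    also have "\<dots> \<le> (card U + 1) * ?F j + (card U + 1) * sum ?F {Suc j..<t}"
      using step by (simp add: Suc_diff_Suc)
    also have "\<dots> = (card U + 1) * sum ?F {j..<t}"
      using step.hyps by (simp add: sum.atLeast_Suc_lessThan distrib_left)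
    finally show ?case .
  qed
  from this[of 0] show ?thesis
    by (simp add: order_maps_above_0[OF U(1)] lessThan_atLeast0)
qed

section \<open>Deleting a minimal element\<close>

text \<open>Giving \<open>x\<close> the value \<open>Suc j\<close> is an injective extension. As
  \<open>x\<close> is minimal, the only new constraints are \<open>Suc j \<le> g u\<close> for
  \<open>u\<close> in \<open>U\<close>, that is, \<open>j < g u\<close>. Only this inequality of the
  two counts is needed.\<close>

lemma sum_card_order_maps_above_le:
  assumes fin: "finite X" and x: "x \<in> X"
    and min: "\<And>y. y \<in> X \<Longrightarrow> (y, x) \<in> R \<Longrightarrow> y = x"
  defines "U \<equiv> {y \<in> X - {x}. (x, y) \<in> R}"
  shows "(\<Sum>j<t. card (order_maps_above (X - {x}) R t U j)) \<le> card (order_maps X R t)"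
proof -
  let ?F = "order_maps_above (X - {x}) R t U"
  have "(\<Sum>j<t. card (?F j)) = card (SIGMA j:{..<t}. ?F j)"
    using fin by (simp add: card_SigmaI finite_order_maps_above)
  also have "\<dots> \<le> card (order_maps X R t)"
  proof (rule card_inj_on_le[of "\<lambda>(j, g). g(x := Suc j)"])
    show "inj_on (\<lambda>(j, g). g(x := Suc j)) (SIGMA j:{..<t}. ?F j)"
    proof (rule inj_onI)
      fix p q
      assume "p \<in> (SIGMA j:{..<t}. ?F j)" "q \<in> (SIGMA j:{..<t}. ?F j)"
        and eq_pq: "(\<lambda>(j, g). g(x := Suc j)) p = (\<lambda>(j, g). g(x := Suc j)) q"
      then obtain j g k h where pq: "p = (j, g)" "q = (k, h)" and g: "g \<in> ?F j" and h: "h \<in> ?F k"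
        by blast
      have eq: "g(x := Suc j) = h(x := Suc k)" using eq_pq pq by simp
      have "j = k" using fun_cong[OF eq, of x] by simp
      moreover have "g y = h y" for y
      proof (cases "y = x")
        case True
        \<comment> \<open>Both maps are extensional on \<open>X - {x}\<close>, so both are
          \<open>undefined\<close> at \<open>x\<close>.\<close>
        then show ?thesis
          using g h by (simp add: order_maps_above_def order_maps_def PiE_iff extensional_def)
      next
        case False
        then show ?thesis using fun_cong[OF eq, of y] by simp
      qed
      ultimately show "p = q" using pq by auto
    qed
    show "(\<lambda>(j, g). g(x := Suc j)) ` (SIGMA j:{..<t}. ?F j) \<subseteq> order_maps X R t"
    proof (rule image_subsetI)
      fix p
      assume "p \<in> (SIGMA j:{..<t}. ?F j)"
      then obtain j g where p: "p = (j, g)" and j: "j < t" and g: "g \<in> ?F j"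
        by blast
      have "g(x := Suc j) \<in> X \<rightarrow>\<^sub>E {1..t}"
        using g j x by (auto simp: order_maps_above_def order_maps_def PiE_iff extensional_def)
      moreover have "(g(x := Suc j)) a \<le> (g(x := Suc j)) b"
        if "a \<in> X" "b \<in> X" "(a, b) \<in> R" "a \<noteq> b" for a b
        using g that min[of a] by (auto simp: order_maps_above_def order_maps_def U_def Suc_le_eq)
      ultimately have "g(x := Suc j) \<in> order_maps X R t"
        unfolding order_maps_def by blast
      then show "(\<lambda>(j, g). g(x := Suc j)) p \<in> order_maps X R t"
        using p by simp
    qed
    show "finite (order_maps X R t)" using fin by (rule finite_order_maps)
  qed
  finally show ?thesis .
qed

section \<open>Induction on the poset\<close>

lemma finite_minimal_element:
  assumes "finite X" "X \<noteq> {}" "antisym R" "trans R"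
  obtains x where "x \<in> X" "\<And>y. y \<in> X \<Longrightarrow> (y, x) \<in> R \<Longrightarrow> y = x"
proof -
  let ?S = "\<lambda>x y. (x, y) \<in> R \<and> x \<noteq> y"
  have "asymp_on X ?S"
    using \<open>antisym R\<close> by (auto intro!: asymp_onI dest: antisymD)
  moreover have "transp_on X ?S"
    using \<open>antisym R\<close> \<open>trans R\<close> by (intro transp_onI) (blast dest: antisymD transD)
  ultimately have "\<exists>x\<in>X. \<forall>y\<in>X. y \<noteq> x \<longrightarrow> \<not> ?S y x"
    using assms(1,2) by (intro Finite_Set.bex_min_element) auto
  then show thesis using that by blast
qed

text \<open>With one factor per element, the induction can split off the factor of a minimal
  element. The hypotheses on \<open>R\<close> are phrased so that they pass to subsets of
  \<open>X\<close> with \<open>R\<close> unchanged.\<close>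

lemma order_polynomial_ge_prod:
  assumes "finite X" "antisym R" "trans R" "\<And>x. x \<in> X \<Longrightarrow> (x, x) \<in> R"
  shows "(\<Prod>x\<in>X. (if x \<in> maximal_elements X R then real t else real t + 1)
                    / real (upper_ideal_size X R x))
           \<le> real (order_polynomial X R t)"
  using assms(1,4)
proof (induction rule: finite_psubset_induct)
  case (psubset X)
  let ?f = "\<lambda>X x. (if x \<in> maximal_elements X R then real t else real t + 1)
                    / real (upper_ideal_size X R x)"
  show ?case
  proof (cases "X = {}")
    case True
    then show ?thesis by (simp add: order_polynomial_eq_card order_maps_def)
  next
    case False
    then obtain x where x: "x \<in> X" and min: "\<And>y. y \<in> X \<Longrightarrow> (y, x) \<in> R \<Longrightarrow> y = x"
      using finite_minimal_element[OF \<open>finite X\<close> _ assms(2,3)] by metis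
    define Q where "Q = X - {x}"
    define U where "U = {y \<in> Q. (x, y) \<in> R}"
    have Q: "Q \<subset> X" "finite Q" "X = insert x Q" "x \<notin> Q"
      using x \<open>finite X\<close> by (auto simp: Q_def)
    have U: "U \<subseteq> Q" "\<And>u y. u \<in> U \<Longrightarrow> y \<in> Q \<Longrightarrow> (u, y) \<in> R \<Longrightarrow> y \<in> U"
      using transD[OF assms(3)] by (auto simp: U_def)
    have "finite U" "x \<notin> U" using U(1) Q finite_subset by auto
    have "{y \<in> X. (x, y) \<in> R} = insert x U"
      using Q(3) psubset.prems[OF x] by (auto simp: U_def)
    then have bx: "upper_ideal_size X R x = card U + 1"
      using \<open>finite U\<close> \<open>x \<notin> U\<close> by (simp add: upper_ideal_size_def)
    have max_x: "x \<in> maximal_elements X R \<longleftrightarrow> U = {}"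
      using Q(3,4) by (auto simp: maximal_elements_def U_def)
    \<comment> \<open>A minimal \<open>x\<close> lies above no other element, so deleting it changes
      neither the upper ideals nor the maximality of the others.\<close>
    have "?f X y = ?f Q y" if "y \<in> Q" for y
    proof -
      have "(y, x) \<notin> R" using min[of y] that Q by auto
      then have "{z \<in> X. (y, z) \<in> R} = {z \<in> Q. (y, z) \<in> R}"
        and "y \<in> maximal_elements X R \<longleftrightarrow> y \<in> maximal_elements Q R"
        using that by (auto simp: Q(3) maximal_elements_def)
      then show ?thesis by (simp add: upper_ideal_size_def)
    qed
    then have prod_eq: "prod (?f X) X = ?f X x * prod (?f Q) Q"
      using Q(2,4) by (subst (2) Q(3)) simp
    have le: "(\<Sum>j<t. card (order_maps_above Q R t U j)) \<le> order_polynomial X R t"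
      using sum_card_order_maps_above_le[OF \<open>finite X\<close> x min]
      by (simp add: order_polynomial_eq_card Q_def U_def)
    have step: "?f X x * real (order_polynomial Q R t) \<le> real (order_polynomial X R t)"
    proof (cases "U = {}")
      case True
      \<comment> \<open>With \<open>U\<close> empty the condition on \<open>j\<close> is void, and
        the sum consists of \<open>t\<close> equal terms.\<close>
      have "t * order_polynomial Q R t \<le> order_polynomial X R t"
        using le by (simp add: True order_maps_above_empty order_polynomial_eq_card)
      then have "real t * real (order_polynomial Q R t) \<le> real (order_polynomial X R t)"
        by (metis of_nat_le_iff of_nat_mult)
      then show ?thesis using True max_x bx by simp
    next
      case False
      have "(t + 1) * order_polynomial Q R t \<le> (card U + 1) * order_polynomial X R t"
        using sum_card_order_maps_above[where R = R and t = t, OF Q(2) U False]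
          mult_le_mono2[OF le, of "card U + 1"]
        unfolding order_polynomial_eq_card by (rule order_trans)
      from of_nat_mono[OF this, where ?'a = real]
      have "(real t + 1) * real (order_polynomial Q R t)
              \<le> (real (card U) + 1) * real (order_polynomial X R t)"
        by (simp only: of_nat_mult of_nat_add of_nat_1)
      then show ?thesis using False max_x bx by (simp add: field_simps)
    qed
    have "prod (?f Q) Q \<le> real (order_polynomial Q R t)"
      using psubset.IH[OF Q(1)] psubset.prems Q(1) by blast
    then have "?f X x * prod (?f Q) Q \<le> ?f X x * real (order_polynomial Q R t)"
      by (intro mult_left_mono) auto
    with step prod_eq show ?thesis by linarith
  qed
qed

theorem theorem1p2:
  fixes X :: "'a set" and R :: "('a \<times> 'a) set" and n r t :: nat
  assumes "finite X" and "partial_order_on X R"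
    and "n = card X" and "r = card (maximal_elements X R)"
  shows "real (order_polynomial X R t)
           \<ge> real t ^ r * (real t + 1) ^ (n - r) * (\<Prod>x\<in>X. 1 / real (upper_ideal_size X R x))"
proof -
  let ?M = "maximal_elements X R"
  have M: "?M \<subseteq> X" by (auto simp: maximal_elements_def)
  have "(\<Prod>x\<in>X. if x \<in> ?M then real t else real t + 1)
          = real t ^ card (X \<inter> ?M) * (real t + 1) ^ card (X \<inter> - ?M)"
    using \<open>finite X\<close> by (simp add: prod.If_cases)
  also have "\<dots> = real t ^ r * (real t + 1) ^ (n - r)"
    using M \<open>finite X\<close> assms(3,4)
    by (simp add: Int_absorb1 card_Diff_subset finite_subset flip: Diff_eq)
  finally have "real t ^ r * (real t + 1) ^ (n - r) * (\<Prod>x\<in>X. 1 / real (upper_ideal_size X R x))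
    = (\<Prod>x\<in>X. (if x \<in> ?M then real t else real t + 1) / real (upper_ideal_size X R x))"
    by (simp add: prod_dividef)
  also have "\<dots> \<le> real (order_polynomial X R t)"
    using assms(1,2)
    by (intro order_polynomial_ge_prod)
      (auto simp: partial_order_on_def preorder_on_def dest: refl_onD)
  finally show ?thesis .
qed

end
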